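(* Let $\{B^\xi_\pm\}_{\xi\in\mathrm{ri}\,\mathcal U}$ be the cocycle family on $(\widehat\Omega,\widehat{\mathfrak S},\widehat{\mathbb P})$ described in the context, and let $\xi\in\mathrm{ri}\,\mathcal U$. Then for $\widehat{\mathbb P}$-a.e. $\widehat\omega$ (and for each sign $\pm$) $$g_{\rm pp}(\xi)=\max_{i=1,2}\{\omega_0-B^\xi_\pm(\widehat\omega,0,e_i)-h_\pm(\xi)\cdot\xi\}=-h_\pm(\xi)\cdot\xi.$$ For any $\theta\in[0,1]$, the cocycle $\widehat{\mathbb E}[\theta B^\xi_-+(1-\theta)B^\xi_+\,|\,\mathfrak S]\in\mathcal K(\Omega)$ is a minimizer in the variational formula $$g_{\rm pp}(\xi)=\inf_{B\in\mathcal K(\Omega)}\ \mathbb P\text{-}\operatorname*{ess\,sup}_\omega\ \max_{i\in\{1,2\}}\{\omega_0-B(\omega,0,e_i)-h(B)\cdot\xi\}.$$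
   Context: **Setting.** $\Omega=\mathbb R^{\mathbb Z^2}$ with Borel $\sigma$-algebra $\mathfrak S$, $\omega=(\omega_x)_{x\in\mathbb Z^2}$, translations $(T_x\omega)_y=\omega_{x+y}$. $\mathbb P$ is a probability measure on $\Omega$ under which $\{\omega_x\}$ are i.i.d., $\mathbb E[|\omega_0|^p]<\infty$ for some $p>2$, $\mathrm{Var}(\omega_0)>0$, $\mathbb P(\omega_0\ge c)=1$ for some $c>-\infty$. $m_0=\mathbb E[\omega_0]$. $e_1=(1,0)$, $e_2=(0,1)$, $x\le y$ coordinatewise. For $x\le y$ in $\mathbb Z^2$, $G_{x,y}=\max\sum_{k=0}^{n-1}\omega_{x_k}$ over up-right paths (increments in $\{e_1,e_2\}$) $x=x_0,\dots,x_n=y$. The a.s. limit $g_{\rm pp}(\xi)=\lim_{n}n^{-1}G_{0,\lfloor n\xi\rfloor}$ ($\xi\in\mathbb R_+^2$) exists, nonrandom, finite; $g_{\rm pp}$ is continuous, concave, symmetric, $1$-homogeneous. $\mathrm{ri}\,\mathcal U=\{te_1+(1-t)e_2:0<t<1\}$. $\mathcal D$: points of $\mathrm{ri}\,\mathcal U$ where $g_{\rm pp}$ is differentiable. One-sided gradients: $\nabla g_{\rm pp}(\zeta\pm)\cdot e_1=\lim_{\varepsilon\searrow0}\frac{g_{\rm pp}(\zeta\pm\varepsilon e_1)-g_{\rm pp}(\zeta)}{\pm\varepsilon}$, $\nabla g_{\rm pp}(\zeta\pm)\cdot e_2=\lim_{\varepsilon\searrow0}\frac{g_{\rm pp}(\zeta\mp\varepsilon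 e_2)-g_{\rm pp}(\zeta)}{\mp\varepsilon}$. **Cocycles.** On a probability space with a translation action, a measurable real function $B(\cdot,x,y)$, $x,y\in\mathbb Z^2$, is a stationary $L^1$ cocycle if $B(0,e_1),B(0,e_2)$ are integrable and, almost surely for all $x,y,z$, $B(\cdot,z+x,z+y)=B(T_z\cdot,x,y)$ and $B(x,y)+B(y,z)=B(x,z)$. $\mathcal K(\Omega)$ is the space of these on $(\Omega,\mathfrak S,\mathbb P)$. $h(B)\in\mathbb R^2$ is defined by $E[B(0,e_i)]=-h(B)\cdot e_i$. The displayed variational formula for $g_{\rm pp}$ is a known identity for $\xi\in\mathrm{ri}\,\mathcal U$. **Cocycle family.** $\widehat\Omega=\Omega\times\mathbb R^{\{1,2\}\times\mathcal A_0\times\mathbb Z^2}$, with $\mathcal A_0$ a certain countable subset of $(m_0,\infty)$; $\widehat\omega=(\omega,\omega')$; $\widehat{\mathfrak S}$ is the Borel $\sigma$-algebra; $\mathfrak S$ also denotes the sub-$\sigma$-algebra generated by $\widehat\omega\mapsto\omega$; translations $T_x$ shift all $\mathbb Z^2$-indexed coordinates. $\widehat{\mathbb P}$ is a translation invariant probability measure on $\widehat\Omega$ and $B^\xi_\pm(\widehat\omega,x,y)$ are real Borel functions of $(\widehat\omega,\xi,x,y)\in\widehat\Omega\times\mathrm{ri}\,\mathcal U\times\mathbb Z^2\times\mathbb Z^2$ such that: (1) the $\omega$-marginal of $\widehat{\mathbb P}$ is $\mathbb P$; for each $\xi,\pm$ the process $x\mapsto(\omega_x,B^\xi_\pm(x,x+e_1),B^\xi_\pm(x,x+e_2))$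 is ergodic under $T_{e_1}$ and under $T_{e_2}$; for any $I\subset\mathbb Z^2$ the variables $\{(\omega_x,B^\xi_+(x,x+e_i),B^\xi_-(x,x+e_i)):x\in I,\xi\in\mathrm{ri}\,\mathcal U,i\in\{1,2\}\}$ are independent of $\{\omega_x:x\not\ge z\ \forall z\in I\}$; (2) each $B^\xi_\pm$ is a stationary $L^1(\widehat{\mathbb P})$ cocycle, $\omega_x=B^\xi_\pm(x,x+e_1)\wedge B^\xi_\pm(x,x+e_2)$ $\widehat{\mathbb P}$-a.s., and $h_\pm(\xi):=h(B^\xi_\pm)=-\nabla g_{\rm pp}(\xi\pm)$; (3) cocycles of the family with equal $h$-vectors are identical for all $\widehat\omega$; in particular for $\xi\in\mathcal D$, $B^\xi_+=B^\xi_-=:B^\xi$; (4) outside a single null set, for all $\xi,\zeta\in\mathrm{ri}\,\mathcal U$ with $\xi\cdot e_1<\zeta\cdot e_1$: $B^\xi_-(x,x+e_1)\ge B^\xi_+(x,x+e_1)\ge B^\zeta_-(x,x+e_1)$ and $B^\xi_-(x,x+e_2)\le B^\xi_+(x,x+e_2)\le B^\zeta_-(x,x+e_2)$; and $B^{\xi_n}_\pm(x,y)\to B^\zeta_+(x,y)$ whenever $\xi_n\cdot e_1\searrow\zeta\cdot e_1$, $\xi_n\ne\zeta$; (5) for each fixed $\zeta$, almost surely $B^{\xi_n}_\pm(x,y)\to B^\zeta_-(x,y)$ for every sequence $\xi_n\cdot e_1\nearrow\zeta\cdot e_1$, $\xi_n\neq\zeta$. Such a family exists. *)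

theory Defs
  imports "HOL-Probability.Probability"
begin

section \<open>Last-passage percolation on the planar lattice\<close>

type_synonym site = "int \<times> int"
type_synonym env = "site \<Rightarrow> real"

text \<open>\<open>evec 1\<close> and \<open>evec 2\<close> are the two coordinate vectors; the index always ranges over
  \<open>{1, 2}\<close>.\<close>

definition evec :: "nat \<Rightarrow> site" where
  "evec i = (if i = 1 then (1, 0) else (0, 1))"

text \<open>Since the lattice is countable, the product sigma-algebra is the Borel sigma-algebra.\<close>

abbreviation Env :: "env measure" where
  "Env \<equiv> PiM UNIV (\<lambda>_. borel)"

definition shift :: "site \<Rightarrow> (site \<Rightarrow> 'a) \<Rightarrow> (site \<Rightarrow> 'a)" where
  "shift x \<omega> = (\<lambda>y. \<omega> (x + y))"

text \<open>A path is a function on the naturals of which only the first \<open>n + 1\<close> values matter.\<close>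

definition up_right_path :: "site \<Rightarrow> site \<Rightarrow> nat \<Rightarrow> (nat \<Rightarrow> site) \<Rightarrow> bool" where
  "up_right_path x y n \<pi> \<longleftrightarrow>
     \<pi> 0 = x \<and> \<pi> n = y \<and> (\<forall>k<n. \<pi> (Suc k) - \<pi> k \<in> {evec 1, evec 2})"

text \<open>Only used for \<open>x \<le> y\<close>, where the set is finite and nonempty. The weight of the endpoint
  \<open>y\<close> is not counted.\<close>

definition last_passage :: "env \<Rightarrow> site \<Rightarrow> site \<Rightarrow> real" where
  "last_passage \<omega> x y = Max {\<Sum>k<n. \<omega> (\<pi> k) | n \<pi>. up_right_path x y n \<pi>}"

definition floor_site :: "real \<times> real \<Rightarrow> site" where
  "floor_site \<xi> = (\<lfloor>fst \<xi>\<rfloor>, \<lfloor>snd \<xi>\<rfloor>)"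

definition lpp_tendsto :: "env measure \<Rightarrow> real \<times> real \<Rightarrow> real \<Rightarrow> bool" where
  "lpp_tendsto P \<xi> c \<longleftrightarrow>
     (AE \<omega> in P. (\<lambda>n. last_passage \<omega> 0 (floor_site (real n *\<^sub>R \<xi>)) / real n) \<longlonglongrightarrow> c)"

definition gpp :: "env measure \<Rightarrow> real \<times> real \<Rightarrow> real" where
  "gpp P \<xi> = (THE c. lpp_tendsto P \<xi> c)"

definition quadrant :: "(real \<times> real) set" where
  "quadrant = {0..} \<times> {0..}"

definition riU :: "(real \<times> real) set" where
  "riU = {t *\<^sub>R (1, 0) + (1 - t) *\<^sub>R (0, 1) | t. 0 < t \<and> t < 1}"

datatype side = Plus | Minus

fun side_sign :: "side \<Rightarrow> real" where
  "side_sign Plus = 1"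
| "side_sign Minus = - 1"

text \<open>\<open>one_sided_grad g s \<zeta>\<close> is the gradient at \<open>\<zeta>\<plusminus>\<close>: moving to the right along the first axis
  goes together with moving down along the second one.\<close>

definition one_sided_grad :: "(real \<times> real \<Rightarrow> real) \<Rightarrow> side \<Rightarrow> real \<times> real \<Rightarrow> real \<times> real" where
  "one_sided_grad g s \<zeta> =
     (let \<sigma> = side_sign s in
      (Lim (at_right 0) (\<lambda>\<epsilon>. (g (\<zeta> + (\<sigma> * \<epsilon>) *\<^sub>R (1, 0)) - g \<zeta>) / (\<sigma> * \<epsilon>)),
       Lim (at_right 0) (\<lambda>\<epsilon>. (g (\<zeta> - (\<sigma> * \<epsilon>) *\<^sub>R (0, 1)) - g \<zeta>) / (- (\<sigma> * \<epsilon>)))))"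

text \<open>The last five assumptions are the classical facts on the limit shape: the almost sure limit
  defining \<^const>\<open>gpp\<close> exists and is a finite constant, and \<^const>\<open>gpp\<close> is continuous, concave,
  symmetric and 1-homogeneous.\<close>

locale lpp_model = prob_space P for P :: "env measure" +
  assumes sets_P: "sets P = sets Env"
    and weights_indep: "indep_vars (\<lambda>_. borel) (\<lambda>x \<omega>. \<omega> x) UNIV"
    and weights_ident: "distr P borel (\<lambda>\<omega>. \<omega> x) = distr P borel (\<lambda>\<omega>. \<omega> 0)"
    and weights_moment: "\<exists>p>2. integrable P (\<lambda>\<omega>. \<bar>\<omega> 0\<bar> powr p)"
    and weights_var: "0 < variance (\<lambda>\<omega>. \<omega> 0)"
    and weights_bdd_below: "\<exists>c. prob {\<omega> \<in> space P. c \<le> \<omega> 0} = 1"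
    and gpp_limit: "\<xi> \<in> quadrant \<Longrightarrow> lpp_tendsto P \<xi> (gpp P \<xi>)"
    and gpp_continuous: "continuous_on quadrant (gpp P)"
    and gpp_concave: "concave_on quadrant (gpp P)"
    and gpp_symmetric: "(a, b) \<in> quadrant \<Longrightarrow> gpp P (b, a) = gpp P (a, b)"
    and gpp_homogeneous: "\<xi> \<in> quadrant \<Longrightarrow> 0 < t \<Longrightarrow> gpp P (t *\<^sub>R \<xi>) = t * gpp P \<xi>"


section \<open>Cocycles\<close>

text \<open>\<open>T\<close> is the translation action on the probability space \<open>M\<close>.\<close>

definition stationary_L1_cocycle ::
  "'w measure \<Rightarrow> (site \<Rightarrow> 'w \<Rightarrow> 'w) \<Rightarrow> ('w \<Rightarrow> site \<Rightarrow> site \<Rightarrow> real) \<Rightarrow> bool" where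
  "stationary_L1_cocycle M T B \<longleftrightarrow>
     (\<forall>x y. (\<lambda>\<omega>. B \<omega> x y) \<in> borel_measurable M) \<and>
     (\<forall>i\<in>{1, 2}. integrable M (\<lambda>\<omega>. B \<omega> 0 (evec i))) \<and>
     (AE \<omega> in M. \<forall>x y z. B \<omega> (z + x) (z + y) = B (T z \<omega>) x y \<and>
                         B \<omega> x y + B \<omega> y z = B \<omega> x z)"

definition cocycles :: "env measure \<Rightarrow> (env \<Rightarrow> site \<Rightarrow> site \<Rightarrow> real) set" where
  "cocycles P = {B. stationary_L1_cocycle P shift B}"

definition hvec :: "'w measure \<Rightarrow> ('w \<Rightarrow> site \<Rightarrow> site \<Rightarrow> real) \<Rightarrow> real \<times> real" where
  "hvec M B = (- (\<integral>\<omega>. B \<omega> 0 (evec 1) \<partial>M), - (\<integral>\<omega>. B \<omega> 0 (evec 2) \<partial>M))"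

text \<open>The functional minimized in the variational formula. It is extended real valued, as the
  essential supremum may be infinite.\<close>

definition var_functional ::
  "env measure \<Rightarrow> real \<times> real \<Rightarrow> (env \<Rightarrow> site \<Rightarrow> site \<Rightarrow> real) \<Rightarrow> ereal" where
  "var_functional P \<xi> B =
     esssup P (\<lambda>\<omega>. ereal (MAX i\<in>{1, 2}. \<omega> 0 - B \<omega> 0 (evec i) - hvec P B \<bullet> \<xi>))"


section \<open>The cocycle family on the extended space\<close>

type_synonym hat_env = "env \<times> (nat \<times> real \<times> site \<Rightarrow> real)"

abbreviation HatEnv :: "real set \<Rightarrow> hat_env measure" where
  "HatEnv A \<equiv> Env \<Otimes>\<^sub>M PiM ({1, 2} \<times> A \<times> UNIV) (\<lambda>_. borel)"

text \<open>Elements of the second factor of \<^const>\<open>HatEnv\<close> are extensional functions; extensionality is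
  preserved by the shift since every site is an admissible third index.\<close>

definition hat_shift :: "site \<Rightarrow> hat_env \<Rightarrow> hat_env" where
  "hat_shift x = (\<lambda>(\<omega>, \<omega>'). (shift x \<omega>, \<lambda>(i, a, y). \<omega>' (i, a, x + y)))"

definition ergodic :: "'a measure \<Rightarrow> ('a \<Rightarrow> 'a) \<Rightarrow> bool" where
  "ergodic M T \<longleftrightarrow>
     T \<in> M \<rightarrow>\<^sub>M M \<and> distr M M T = M \<and>
     (\<forall>A\<in>sets M. T -` A \<inter> space M = A \<longrightarrow> A \<in> null_sets M \<or> space M - A \<in> null_sets M)"

text \<open>Ergodicity of a process indexed by the lattice is ergodicity of its law on path space.\<close>

definition ergodic_process ::
  "'w measure \<Rightarrow> ('w \<Rightarrow> site \<Rightarrow> 'b::topological_space) \<Rightarrow> site \<Rightarrow> bool" where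
  "ergodic_process M X z \<longleftrightarrow>
     X \<in> M \<rightarrow>\<^sub>M PiM UNIV (\<lambda>_. borel) \<and>
     ergodic (distr M (PiM UNIV (\<lambda>_. borel)) X) (shift z)"

definition gen_sigma ::
  "'w measure \<Rightarrow> 'i set \<Rightarrow> ('i \<Rightarrow> 'w \<Rightarrow> 'b::topological_space) \<Rightarrow> 'w set set" where
  "gen_sigma M J X =
     sigma_sets (space M) (\<Union>j\<in>J. {X j -` S \<inter> space M | S. S \<in> sets borel})"

text \<open>In the locale below, \<open>B s \<xi> w x y\<close> stands for the cocycle with sign \<open>s\<close> and direction \<open>\<xi>\<close>
  at the extended environment \<open>w\<close>, whose first component is the environment of weights.
  Statements of the form AE with an inner quantification over all directions mean that there is
  one null set outside of which the inner statement holds.\<close>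

locale cocycle_family = lpp_model P + hat: prob_space Ph
  for P :: "env measure" and Ph :: "hat_env measure" +
  fixes A :: "real set"
    and B :: "side \<Rightarrow> real \<times> real \<Rightarrow> hat_env \<Rightarrow> site \<Rightarrow> site \<Rightarrow> real"
  assumes A_countable: "countable A"
    and A_subset: "A \<subseteq> {expectation (\<lambda>\<omega>. \<omega> 0)<..}"
    and sets_Ph: "sets Ph = sets (HatEnv A)"
    and Ph_invariant: "distr Ph Ph (hat_shift z) = Ph"
    and B_borel:
      "(\<lambda>(w, \<xi>, x, y). B s \<xi> w x y) \<in>
         borel_measurable (HatEnv A \<Otimes>\<^sub>M restrict_space borel riU \<Otimes>\<^sub>M
           count_space UNIV \<Otimes>\<^sub>M count_space UNIV)"
    and marginal: "distr Ph Env fst = P"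
    and B_ergodic:
      "\<xi> \<in> riU \<Longrightarrow> i \<in> {1, 2} \<Longrightarrow>
         ergodic_process Ph
           (\<lambda>w x. (fst w x, B s \<xi> w x (x + evec 1), B s \<xi> w x (x + evec 2))) (evec i)"
    and B_indep:
      "hat.indep_set
         (gen_sigma Ph (I \<times> riU \<times> {1, 2})
           (\<lambda>(x, \<xi>, i) w. (fst w x, B Plus \<xi> w x (x + evec i), B Minus \<xi> w x (x + evec i))))
         (gen_sigma Ph {x. \<forall>z\<in>I. \<not> z \<le> x} (\<lambda>x w. fst w x))"
    and B_cocycle: "\<xi> \<in> riU \<Longrightarrow> stationary_L1_cocycle Ph hat_shift (B s \<xi>)"
    and B_recovery:
      "\<xi> \<in> riU \<Longrightarrow>
         AE w in Ph. \<forall>x. fst w x = min (B s \<xi> w x (x + evec 1)) (B s \<xi> w x (x + evec 2))"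
    and B_hvec: "\<xi> \<in> riU \<Longrightarrow> hvec Ph (B s \<xi>) = - one_sided_grad (gpp P) s \<xi>"
    and B_eq_of_hvec_eq:
      "\<xi> \<in> riU \<Longrightarrow> \<zeta> \<in> riU \<Longrightarrow> hvec Ph (B s \<xi>) = hvec Ph (B t \<zeta>) \<Longrightarrow> w \<in> space Ph \<Longrightarrow>
         B s \<xi> w x y = B t \<zeta> w x y"
    and B_differentiable:
      "\<xi> \<in> riU \<Longrightarrow> gpp P differentiable (at \<xi>) \<Longrightarrow> w \<in> space Ph \<Longrightarrow>
         B Plus \<xi> w x y = B Minus \<xi> w x y"
    and B_monotone:
      "AE w in Ph. \<forall>\<xi>\<in>riU. \<forall>\<zeta>\<in>riU. fst \<xi> < fst \<zeta> \<longrightarrow> (\<forall>x.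
         B Minus \<xi> w x (x + evec 1) \<ge> B Plus \<xi> w x (x + evec 1) \<and>
         B Plus \<xi> w x (x + evec 1) \<ge> B Minus \<zeta> w x (x + evec 1) \<and>
         B Minus \<xi> w x (x + evec 2) \<le> B Plus \<xi> w x (x + evec 2) \<and>
         B Plus \<xi> w x (x + evec 2) \<le> B Minus \<zeta> w x (x + evec 2))"
    and B_right_limit:
      "AE w in Ph. \<forall>\<zeta>\<in>riU. \<forall>Z. (\<forall>n. Z n \<in> riU \<and> Z n \<noteq> \<zeta>) \<longrightarrow>
         decseq (\<lambda>n. fst (Z n)) \<longrightarrow> (\<lambda>n. fst (Z n)) \<longlonglongrightarrow> fst \<zeta> \<longrightarrow>
         (\<forall>s x y. (\<lambda>n. B s (Z n) w x y) \<longlonglongrightarrow> B Plus \<zeta> w x y)"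
    and B_left_limit:
      "\<zeta> \<in> riU \<Longrightarrow> AE w in Ph. \<forall>Z. (\<forall>n. Z n \<in> riU \<and> Z n \<noteq> \<zeta>) \<longrightarrow>
         incseq (\<lambda>n. fst (Z n)) \<longrightarrow> (\<lambda>n. fst (Z n)) \<longlonglongrightarrow> fst \<zeta> \<longrightarrow>
         (\<forall>s x y. (\<lambda>n. B s (Z n) w x y) \<longlonglongrightarrow> B Minus \<zeta> w x y)"

text \<open>\<open>C\<close>, a function of the weights \<open>\<omega>\<close> alone, is a version of the conditional expectation of the
  process \<open>D\<close> given the sigma-algebra generated by the projection to the weights. Versions are
  defined on the original space so that membership in \<^const>\<open>cocycles\<close> makes sense.\<close>

definition cond_exp_version ::
  "env measure \<Rightarrow> hat_env measure \<Rightarrow> (hat_env \<Rightarrow> site \<Rightarrow> site \<Rightarrow> real) \<Rightarrow>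
     (env \<Rightarrow> site \<Rightarrow> site \<Rightarrow> real) \<Rightarrow> bool" where
  "cond_exp_version P Ph D C \<longleftrightarrow>
     (\<forall>x y. (\<lambda>\<omega>. C \<omega> x y) \<in> borel_measurable P \<and>
        (AE w in Ph. C (fst w) x y =
           real_cond_exp Ph (vimage_algebra (space Ph) fst P) (\<lambda>w. D w x y) w))"

end

theory Submission
  imports Defs
begin

text \<open>
  The limit shape \<open>g\<close> is homogeneous and concave, so Euler's identity holds for its one-sided
  gradients (\<open>euler_one_sided_grad\<close>). Since \<open>h\<close> is minus such a gradient, \<open>- h \<bullet> \<xi> = g \<xi>\<close> for the
  cocycles of both signs. Recovery says that the weight at the origin is the smaller of the two
  increments there, so the maximum over \<open>i\<close> of \<open>\<omega> 0 - B 0 (evec i)\<close> vanishes; this is the first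
  assertion.

  That no cocycle \<open>C\<close> does better than \<open>g \<xi>\<close> in the variational formula is seen as follows
  (\<open>gpp_le_var_functional\<close>). If the functional of \<open>C\<close> is at most \<open>k\<close>, then by stationarity every
  weight is at most \<open>k + h \<bullet> \<xi>\<close> plus the increment of \<open>C\<close> along either outgoing edge. Summed along
  a maximizing path these increments telescope, so the last-passage time to a site \<open>v\<close> near \<open>n \<xi>\<close>
  is at most about \<open>n (k + h \<bullet> \<xi>)\<close> plus the value of \<open>C\<close> from \<open>0\<close> to \<open>v\<close>, whose mean is exactly
  \<open>- h \<bullet> v\<close> (\<open>cocycle_mean\<close>). After division by \<open>n\<close> the means of this upper bound tend to \<open>k\<close>,
  while the last-passage times tend to \<open>g \<xi>\<close> almost surely. As the weights are bounded below,
  Fatou's lemma applies and gives \<open>g \<xi> \<le> k\<close>.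

  Conversely, the conditional expectation of a convex combination of the two cocycles given the
  weights is again a stationary cocycle with the averaged \<open>h\<close> (\<open>cond_exp_version_cocycle\<close>). Its
  increments still dominate the weight (\<open>cond_exp_version_ge_weight\<close>), so its functional is at
  most \<open>- h \<bullet> \<xi> = g \<xi>\<close>. With the lower bound this gives at once the variational formula and the
  minimizing property (\<open>mixture_var_functional\<close>).
\<close>

section \<open>One-sided gradients of the limit shape\<close>

text \<open>The difference quotients of a concave function increase as the step shrinks, and are bounded
  above by a difference quotient taken on the other side of the point.\<close>

lemma directional_derivative_exists:
  fixes g :: "'a::real_vector \<Rightarrow> real"
  assumes concave: "concave_on S g" and "\<delta> > 0"
    and seg: "x - \<delta> *\<^sub>R v \<in> S" "x \<in> S" "x + \<delta> *\<^sub>R v \<in> S"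
  shows "\<exists>l. ((\<lambda>t. (g (x + t *\<^sub>R v) - g x) / t) \<longlongrightarrow> l) (at_right 0)"
proof -
  define q where "q t = (g (x + t *\<^sub>R v) - g x) / t" for t
  have "convex S" using concave by (simp add: concave_on_def convex_on_def)
  have combine: "(1 - u) * g y + u * g z \<le> g ((1 - u) *\<^sub>R y + u *\<^sub>R z)"
    if "y \<in> S" "z \<in> S" "0 \<le> u" "u \<le> 1" for y z u
    using concave that unfolding concave_on_iff by (metis diff_add_cancel diff_ge_0_iff_ge)
  have inS: "x + t *\<^sub>R v \<in> S" if "0 < t" "t \<le> \<delta>" for t
  proof -
    have "(1 - t/\<delta>) *\<^sub>R x + (t/\<delta>) *\<^sub>R (x + \<delta> *\<^sub>R v) \<in> S"
      using \<open>convex S\<close> seg that by (intro convexD) auto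
    also have "(1 - t/\<delta>) *\<^sub>R x + (t/\<delta>) *\<^sub>R (x + \<delta> *\<^sub>R v) = x + t *\<^sub>R v"
      using \<open>\<delta> > 0\<close> by (simp add: algebra_simps)
    finally show ?thesis .
  qed
  have anti: "q t \<le> q s" if "0 < s" "s \<le> t" "t \<le> \<delta>" for s t
  proof -
    have "(1 - s/t) *\<^sub>R x + (s/t) *\<^sub>R (x + t *\<^sub>R v) = x + s *\<^sub>R v"
      using that by (simp add: algebra_simps)
    then have "(1 - s/t) * g x + (s/t) * g (x + t *\<^sub>R v) \<le> g (x + s *\<^sub>R v)"
      using combine[of x "x + t *\<^sub>R v" "s/t"] inS[of t] seg that by simp
    then have "(s/t) * (g (x + t *\<^sub>R v) - g x) \<le> g (x + s *\<^sub>R v) - g x"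
      by (simp add: algebra_simps)
    then show ?thesis using that by (simp add: q_def field_simps)
  qed
  have bdd: "q s \<le> (g x - g (x - \<delta> *\<^sub>R v)) / \<delta>" if "0 < s" "s \<le> \<delta>" for s
  proof -
    have "(1 - \<delta>/(s+\<delta>)) *\<^sub>R (x - \<delta> *\<^sub>R v) + (\<delta>/(s+\<delta>)) *\<^sub>R (x + s *\<^sub>R v)
        = x + ((\<delta>/(s+\<delta>)) * s - (1 - \<delta>/(s+\<delta>)) * \<delta>) *\<^sub>R v"
      by (simp add: algebra_simps)
    also have "(\<delta>/(s+\<delta>)) * s - (1 - \<delta>/(s+\<delta>)) * \<delta> = 0"
      using that \<open>\<delta> > 0\<close> by (simp add: field_simps)
    finally have "(1 - \<delta>/(s+\<delta>)) * g (x - \<delta> *\<^sub>R v) + (\<delta>/(s+\<delta>)) * g (x + s *\<^sub>R v) \<le> g x"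
      using combine[of "x - \<delta> *\<^sub>R v" "x + s *\<^sub>R v" "\<delta>/(s+\<delta>)"] inS[of s] seg that \<open>\<delta> > 0\<close> by simp
    moreover have "1 - \<delta>/(s+\<delta>) = s/(s+\<delta>)"
      using that \<open>\<delta> > 0\<close> by (simp add: field_simps)
    ultimately have "(s * g (x - \<delta> *\<^sub>R v) + \<delta> * g (x + s *\<^sub>R v)) / (s+\<delta>) \<le> g x"
      by (simp add: add_divide_distrib)
    then have "s * g (x - \<delta> *\<^sub>R v) + \<delta> * g (x + s *\<^sub>R v) \<le> (s + \<delta>) * g x"
      using that \<open>\<delta> > 0\<close> by (simp add: pos_divide_le_eq mult.commute)
    then show ?thesis using that \<open>\<delta> > 0\<close> by (simp add: q_def field_simps)
  qed
  define l where "l = (SUP t\<in>{0<..\<delta>}. q t)"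
  have bddabove: "bdd_above (q ` {0<..\<delta>})" using bdd by (intro bdd_aboveI2) auto
  have ev: "eventually (\<lambda>t. 0 < t \<and> t \<le> r) (at_right 0)" if "r > 0" for r :: real
    using eventually_at_right_real[OF that] by eventually_elim auto
  have "(q \<longlongrightarrow> l) (at_right 0)"
  proof (rule order_tendstoI)
    fix a assume "a < l"
    then obtain r where r: "r \<in> {0<..\<delta>}" "a < q r"
      unfolding l_def using less_cSUP_iff[OF _ bddabove] \<open>\<delta> > 0\<close> by auto
    then show "\<forall>\<^sub>F t in at_right 0. a < q t"
      using anti[of _ r] ev[of r] by (auto elim!: eventually_mono) (meson less_le_trans)
  next
    fix a assume "l < a"
    have "\<forall>\<^sub>F t in at_right 0. q t \<le> l"
      using ev[OF \<open>\<delta> > 0\<close>] by eventually_elim (auto simp: l_def intro!: cSUP_upper bddabove)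
    then show "\<forall>\<^sub>F t in at_right 0. q t < a"
      by eventually_elim (use \<open>l < a\<close> in auto)
  qed
  then show ?thesis unfolding q_def by blast
qed

text \<open>Euler's identity for one-sided gradients. A step down along the second axis and a suitable
  step to the right along the first axis end on a common ray from the origin, so homogeneity
  expresses either increment of \<open>g\<close> through the other. This is why the two components of the
  gradient at \<open>\<zeta>\<plusminus>\<close> move in opposite directions: both are then governed by the same one-sided
  derivative.\<close>

lemma euler_one_sided_grad:
  assumes concave: "concave_on quadrant g"
    and homogeneous: "\<And>\<zeta> t. \<zeta> \<in> quadrant \<Longrightarrow> 0 < t \<Longrightarrow> g (t *\<^sub>R \<zeta>) = t * g \<zeta>"
    and "0 < a" "0 < b"
  shows "one_sided_grad g s (a, b) \<bullet> (a, b) = g (a, b)"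
proof -
  define \<sigma> where "\<sigma> = side_sign s"
  have \<sigma>: "\<sigma> = 1 \<or> \<sigma> = -1" unfolding \<sigma>_def by (cases s) auto
  define q1 where "q1 = (\<lambda>\<epsilon>. (g ((a, b) + (\<sigma> * \<epsilon>) *\<^sub>R (1, 0)) - g (a, b)) / (\<sigma> * \<epsilon>))"
  define q2 where "q2 = (\<lambda>\<epsilon>. (g ((a, b) - (\<sigma> * \<epsilon>) *\<^sub>R (0, 1)) - g (a, b)) / (- (\<sigma> * \<epsilon>)))"
  have "\<exists>l. ((\<lambda>t. (g ((a, b) + t *\<^sub>R (\<sigma>, 0)) - g (a, b)) / t) \<longlongrightarrow> l) (at_right 0)"
    by (rule directional_derivative_exists[OF concave \<open>0 < a\<close>])
       (use assms \<sigma> in \<open>auto simp: quadrant_def\<close>)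
  then obtain l where "((\<lambda>t. (g ((a, b) + t *\<^sub>R (\<sigma>, 0)) - g (a, b)) / t) \<longlongrightarrow> l) (at_right 0)"
    by blast
  then have "((\<lambda>t. (g ((a, b) + t *\<^sub>R (\<sigma>, 0)) - g (a, b)) / t / \<sigma>) \<longlongrightarrow> l / \<sigma>) (at_right 0)"
    by (rule tendsto_divide[OF _ tendsto_const]) (use \<sigma> in auto)
  moreover have "(\<lambda>t. (g ((a, b) + t *\<^sub>R (\<sigma>, 0)) - g (a, b)) / t / \<sigma>) = q1"
    by (auto simp: q1_def mult.commute)
  ultimately have q1: "(q1 \<longlongrightarrow> l / \<sigma>) (at_right 0)" by simp
  \<comment> \<open>The points \<open>(a, b - \<sigma> \<delta>)\<close> and \<open>(a + \<sigma> \<epsilon>, b)\<close> lie on a common ray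
    exactly if \<open>\<epsilon> = a \<delta> / (b - \<sigma> \<delta>)\<close>.\<close>
  define r where "r \<delta> = a * \<delta> / (b - \<sigma> * \<delta>)" for \<delta>
  have ev: "\<forall>\<^sub>F \<delta> in at_right 0. 0 < \<delta> \<and> \<delta> < b"
    using eventually_at_right_real[OF \<open>0 < b\<close>] by eventually_elim auto
  have rel: "q2 \<delta> = g (a, b) / b - (a / b) * q1 (r \<delta>)" if "0 < \<delta>" "\<delta> < b" for \<delta>
  proof -
    define m where "m = (b - \<sigma> * \<delta>) / b"
    have pos: "b - \<sigma> * \<delta> > 0" using \<sigma> that \<open>0 < b\<close> by auto
    then have m: "m > 0" using \<open>0 < b\<close> by (simp add: m_def)
    have "a + \<sigma> * r \<delta> = a / m"
      using pos \<open>0 < b\<close> by (simp add: r_def m_def field_simps)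
    moreover have mb: "m * b = b - \<sigma> * \<delta>" using \<open>0 < b\<close> by (simp add: m_def)
    ultimately have pt: "(a, b - \<sigma> * \<delta>) = m *\<^sub>R (a + \<sigma> * r \<delta>, b)"
      using m \<open>a + \<sigma> * r \<delta> = a / m\<close> mb by simp
    have "g (a, b - \<sigma> * \<delta>) = m * g (a + \<sigma> * r \<delta>, b)"
      unfolding pt using m \<open>0 < a\<close> \<open>0 < b\<close> \<open>a + \<sigma> * r \<delta> = a / m\<close>
      by (intro homogeneous) (auto simp: quadrant_def)
    then have q2: "q2 \<delta> = (m * g (a + \<sigma> * r \<delta>, b) - g (a, b)) / (- (\<sigma> * \<delta>))"
      by (simp add: q2_def)
    have q1: "q1 (r \<delta>) = (g (a + \<sigma> * r \<delta>, b) - g (a, b)) / (\<sigma> * r \<delta>)"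
      by (simp add: q1_def)
    have \<delta>: "\<sigma> * \<delta> = b * (1 - m)" using mb by (simp add: algebra_simps)
    have "\<sigma> * r \<delta> = a * (1 - m) / m"
      using \<open>a + \<sigma> * r \<delta> = a / m\<close> m by (simp add: field_simps)
    moreover have "1 - m \<noteq> 0"
      using \<delta> \<sigma> that by auto
    moreover have "(m * G - c) / (- (b * (1 - m))) = c / b - (a / b) * ((G - c) / (a * (1 - m) / m))"
      if "1 - m \<noteq> 0" for G c
      using that m \<open>0 < a\<close> \<open>0 < b\<close> by (simp add: divide_simps) (simp add: algebra_simps)
    ultimately show ?thesis
      unfolding q1 q2 \<delta> by metis
  qed
  have "filterlim r (at_right 0) (at_right 0)"
    unfolding filterlim_at
  proof
    show "\<forall>\<^sub>F x in at_right 0. r x \<in> {0<..} \<and> r x \<noteq> 0"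
      using ev by eventually_elim (use \<sigma> \<open>0 < a\<close> in \<open>auto simp: r_def\<close>)
    have "(r \<longlongrightarrow> a * 0 / (b - \<sigma> * 0)) (at_right 0)"
      unfolding r_def using \<open>0 < b\<close> by (intro tendsto_intros) auto
    then show "(r \<longlongrightarrow> 0) (at_right 0)" by simp
  qed
  then have "((\<lambda>\<delta>. q1 (r \<delta>)) \<longlongrightarrow> l / \<sigma>) (at_right 0)"
    using q1 by (rule filterlim_compose[rotated])
  then have "((\<lambda>\<delta>. g (a, b) / b - (a / b) * q1 (r \<delta>)) \<longlongrightarrow> g (a, b) / b - (a / b) * (l / \<sigma>)) (at_right 0)"
    by (intro tendsto_intros)
  then have q2: "(q2 \<longlongrightarrow> g (a, b) / b - (a / b) * (l / \<sigma>)) (at_right 0)"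
    by (rule Lim_transform_eventually) (use ev in \<open>eventually_elim, use rel in auto\<close>)
  have "one_sided_grad g s (a, b) = (l / \<sigma>, g (a, b) / b - (a / b) * (l / \<sigma>))"
    unfolding one_sided_grad_def Let_def \<sigma>_def[symmetric]
    using tendsto_Lim[OF _ q1] tendsto_Lim[OF _ q2] by (simp add: q1_def q2_def)
  then show ?thesis using \<open>0 < b\<close> by (simp add: inner_prod_def field_simps)
qed

section \<open>Means of stationary cocycles\<close>

lemma evec_1 [simp]: "evec 1 = (1, 0)" "evec (Suc 0) = (1, 0)"
  and evec_2 [simp]: "evec 2 = (0, 1)"
  by (simp_all add: evec_def)

definition real_site :: "site \<Rightarrow> real \<times> real" where
  "real_site x = (real_of_int (fst x), real_of_int (snd x))"

lemma real_site_diff: "real_site (x - y) = real_site x - real_site y"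
  by (simp add: real_site_def)

lemma stationary_L1_cocycleD:
  assumes "stationary_L1_cocycle M T B"
  shows "(\<lambda>\<omega>. B \<omega> x y) \<in> borel_measurable M"
    and "i \<in> {1, 2} \<Longrightarrow> integrable M (\<lambda>\<omega>. B \<omega> 0 (evec i))"
    and "AE \<omega> in M. \<forall>x y z. B \<omega> (z + x) (z + y) = B (T z \<omega>) x y \<and> B \<omega> x y + B \<omega> y z = B \<omega> x z"
  using assms unfolding stationary_L1_cocycle_def by blast+

text \<open>The mean of a stationary cocycle is exactly linear in the displacement, since the relation
  expressing this is closed under composition and reversal and holds for all unit steps. It is
  through these means that cocycles enter the lower bound below.\<close>

lemma cocycle_mean:
  assumes cocycle: "stationary_L1_cocycle M T B"
    and T: "\<And>z. T z \<in> M \<rightarrow>\<^sub>M M" "\<And>z. distr M M (T z) = M"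
  shows "integrable M (\<lambda>\<omega>. B \<omega> x y) \<and> (\<integral>\<omega>. B \<omega> x y \<partial>M) = - hvec M B \<bullet> real_site (y - x)"
proof -
  define Q where "Q x y \<longleftrightarrow> integrable M (\<lambda>\<omega>. B \<omega> x y) \<and>
    (\<integral>\<omega>. B \<omega> x y \<partial>M) = - hvec M B \<bullet> real_site (y - x)" for x y
  note meas = stationary_L1_cocycleD(1)[OF cocycle]
  note integrable0 = stationary_L1_cocycleD(2)[OF cocycle]
  note rule = stationary_L1_cocycleD(3)[OF cocycle]
  have step: "Q z (z + evec i)" if i: "i \<in> {1, 2}" for z i
  proof -
    have ae: "AE \<omega> in M. B \<omega> z (z + evec i) = B (T z \<omega>) 0 (evec i)"
      using rule by eventually_elim (metis add_0_right)
    have "integrable (distr M M (T z)) (\<lambda>\<omega>. B \<omega> 0 (evec i))"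
      using integrable0[OF i] by (simp add: T)
    then have "integrable M (\<lambda>\<omega>. B (T z \<omega>) 0 (evec i))"
      by (subst (asm) integrable_distr_eq) (auto intro: T meas)
    moreover have m: "(\<lambda>\<omega>. B (T z \<omega>) 0 (evec i)) \<in> borel_measurable M"
      using measurable_compose[OF T(1) meas] .
    ultimately have "integrable M (\<lambda>\<omega>. B \<omega> z (z + evec i))"
      using integrable_cong_AE[OF meas m ae] by simp
    moreover have "(\<integral>\<omega>. B \<omega> z (z + evec i) \<partial>M) = (\<integral>\<omega>. B \<omega> 0 (evec i) \<partial>M)"
    proof -
      have "(\<integral>\<omega>. B \<omega> z (z + evec i) \<partial>M) = (\<integral>\<omega>. B (T z \<omega>) 0 (evec i) \<partial>M)"
        by (rule integral_cong_AE[OF meas m ae])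
      also have "\<dots> = (\<integral>\<omega>. B \<omega> 0 (evec i) \<partial>distr M M (T z))"
        by (rule integral_distr[symmetric]) (auto intro: T meas)
      finally show ?thesis by (simp add: T)
    qed
    ultimately show ?thesis using i by (auto simp: Q_def hvec_def real_site_def inner_prod_def)
  qed
  have comp: "Q x z" if "Q x y" "Q y z" for x y z
  proof -
    have ae: "AE \<omega> in M. B \<omega> x z = B \<omega> x y + B \<omega> y z" using rule by eventually_elim metis
    have int: "integrable M (\<lambda>\<omega>. B \<omega> x y + B \<omega> y z)" using that by (simp add: Q_def)
    then have "integrable M (\<lambda>\<omega>. B \<omega> x z)"
      using integrable_cong_AE[OF meas _ ae] by simp
    moreover have "(\<integral>\<omega>. B \<omega> x z \<partial>M) = (\<integral>\<omega>. B \<omega> x y \<partial>M) + (\<integral>\<omega>. B \<omega> y z \<partial>M)"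
      using integral_cong_AE[OF meas _ ae] int that by (simp add: Q_def)
    ultimately show ?thesis using that
      by (simp add: Q_def real_site_diff inner_diff_right)
  qed
  have rev: "Q y x" if "Q x y" for x y
  proof -
    have ae: "AE \<omega> in M. B \<omega> y x = - B \<omega> x y"
      using rule by eventually_elim (smt (verit))
    have "integrable M (\<lambda>\<omega>. B \<omega> y x)"
      using integrable_cong_AE[OF meas _ ae] meas that by (simp add: Q_def)
    moreover have "(\<integral>\<omega>. B \<omega> y x \<partial>M) = - (\<integral>\<omega>. B \<omega> x y \<partial>M)"
      using integral_cong_AE[OF meas _ ae] meas that by simp
    ultimately show ?thesis using that
      by (simp add: Q_def real_site_diff inner_diff_right)
  qed
  have refl: "Q x x" for x using comp[OF step rev[OF step]] by blast
  have horizontal: "Q x (x + (k, 0))" for x k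
  proof (induction k rule: int_induct[where k = 0])
    case base then show ?case using refl by (simp flip: zero_prod_def)
  next
    case (step1 k)
    then show ?case using comp[OF step1(2) step[of 1]] by (simp add: algebra_simps)
  next
    case (step2 k)
    have "Q (x + (k - 1, 0)) (x + (k, 0))"
      using step[of 1 "x + (k - 1, 0)"] by (simp add: algebra_simps)
    then show ?case using comp[OF step2(2) rev] by blast
  qed
  have vertical: "Q x (x + (0, k))" for x k
  proof (induction k rule: int_induct[where k = 0])
    case base then show ?case using refl by (simp flip: zero_prod_def)
  next
    case (step1 k)
    then show ?case using comp[OF step1(2) step[of 2]] by (simp add: algebra_simps)
  next
    case (step2 k)
    have "Q (x + (0, k - 1)) (x + (0, k))"
      using step[of 2 "x + (0, k - 1)"] by (simp add: algebra_simps)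
    then show ?case using comp[OF step2(2) rev] by blast
  qed
  have "y = x + (fst (y - x), 0) + (0, snd (y - x))" by (simp add: prod_eq_iff)
  then have "Q x y" using comp[OF horizontal vertical] by metis
  then show ?thesis by (simp add: Q_def)
qed

section \<open>Last-passage times along paths\<close>

lemma up_right_path_length:
  assumes "up_right_path x y n \<pi>"
  shows "int n = fst (y - x) + snd (y - x)"
proof -
  have "k \<le> n \<Longrightarrow> int k = fst (\<pi> k - x) + snd (\<pi> k - x)" for k
  proof (induction k)
    case 0 then show ?case using assms by (simp add: up_right_path_def)
  next
    case (Suc k)
    then have "\<pi> (Suc k) - \<pi> k \<in> {evec 1, evec 2}" using assms by (auto simp: up_right_path_def)
    then show ?case using Suc by (auto simp: prod_eq_iff)
  qed
  from this[of n] show ?thesis using assms by (simp add: up_right_path_def)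
qed

lemma up_right_path_exists:
  assumes "0 \<le> fst (y - x)" "0 \<le> snd (y - x)"
  shows "\<exists>n \<pi>. up_right_path x y n \<pi>"
proof -
  define i where "i = nat (fst (y - x))"
  define j where "j = nat (snd (y - x))"
  have "up_right_path x y (i + j) (\<lambda>k. x + (int (min k i), int (k - i)))"
    unfolding up_right_path_def
  proof (intro conjI allI impI)
    fix k assume "k < i + j"
    show "x + (int (min (Suc k) i), int (Suc k - i)) - (x + (int (min k i), int (k - i)))
        \<in> {evec 1, evec 2}"
      by (cases "k < i") (auto simp: Suc_diff_le)
  qed (use assms in \<open>auto simp: prod_eq_iff i_def j_def\<close>)
  then show ?thesis by blast
qed

text \<open>The maximum defining the last-passage time is meaningful because only finitely many values
  occur. The paths themselves are infinitely many, as their values beyond the endpoint are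
  arbitrary; the induction therefore runs over pairs of an endpoint and a path sum.\<close>

lemma finite_path_sums: "finite {\<Sum>k<n. \<omega> (\<pi> k) :: real | n \<pi>. up_right_path x y n \<pi>}"
proof -
  define V where
    "V n = {(\<pi> n, \<Sum>k<n. \<omega> (\<pi> k)) | \<pi>. up_right_path x (\<pi> n) n \<pi>}" for n
  have finV: "finite (V n)" for n
  proof (induction n)
    case 0
    have "V 0 \<subseteq> {(x, 0)}" by (auto simp: V_def up_right_path_def)
    then show ?case using finite_subset by blast
  next
    case (Suc n)
    have "V (Suc n) \<subseteq> (\<Union>e\<in>{evec 1, evec 2}. (\<lambda>(z, s). (z + e, s + \<omega> z)) ` V n)"
    proof
      fix p assume "p \<in> V (Suc n)"
      then obtain \<pi> where p: "p = (\<pi> (Suc n), \<Sum>k<Suc n. \<omega> (\<pi> k))"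
        and \<pi>: "up_right_path x (\<pi> (Suc n)) (Suc n) \<pi>" by (auto simp: V_def)
      define e where "e = \<pi> (Suc n) - \<pi> n"
      have e: "e \<in> {evec 1, evec 2}" using \<pi> by (auto simp: up_right_path_def e_def)
      have "up_right_path x (\<pi> n) n \<pi>" using \<pi> by (simp add: up_right_path_def)
      then have "(\<pi> n, \<Sum>k<n. \<omega> (\<pi> k)) \<in> V n" unfolding V_def by blast
      then have "p \<in> (\<lambda>(z, s). (z + e, s + \<omega> z)) ` V n"
        by (rule rev_image_eqI) (simp add: p e_def)
      then show "p \<in> (\<Union>e\<in>{evec 1, evec 2}. (\<lambda>(z, s). (z + e, s + \<omega> z)) ` V n)"
        using e by blast
    qed
    then show ?case by (rule finite_subset) (use Suc in simp)
  qed
  have "{\<Sum>k<n. \<omega> (\<pi> k) | n \<pi>. up_right_path x y n \<pi>} \<subseteq> snd ` V (nat (fst (y - x) + snd (y - x)))"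
  proof safe
    fix n \<pi> assume \<pi>: "up_right_path x y n \<pi>"
    then have "n = nat (fst (y - x) + snd (y - x))"
      using up_right_path_length[OF \<pi>] by simp
    moreover have "(y, \<Sum>k<n. \<omega> (\<pi> k)) \<in> V n" using \<pi> by (auto simp: V_def up_right_path_def)
    ultimately show "(\<Sum>k<n. \<omega> (\<pi> k)) \<in> snd ` V (nat (fst (y - x) + snd (y - x)))"
      by force
  qed
  then show ?thesis using finV finite_subset by blast
qed

text \<open>If each weight is at most \<open>K\<close> plus the increment of an additive function \<open>F\<close> along either
  outgoing edge, the increments telescope along every path, and all paths from \<open>x\<close> to \<open>y\<close> have
  the same length.\<close>

lemma last_passage_bounds:
  fixes F :: "site \<Rightarrow> site \<Rightarrow> real"
  assumes le: "0 \<le> fst (y - x)" "0 \<le> snd (y - x)"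
    and lower: "\<And>z. c \<le> \<omega> z"
    and upper: "\<And>z i. i \<in> {1, 2} \<Longrightarrow> \<omega> z \<le> K + F z (z + evec i)"
    and additive: "\<And>u v z. F u v + F v z = F u z"
  shows "of_int (fst (y - x) + snd (y - x)) * c \<le> last_passage \<omega> x y"
    and "last_passage \<omega> x y \<le> of_int (fst (y - x) + snd (y - x)) * K + F x y"
proof -
  let ?S = "{\<Sum>k<n. \<omega> (\<pi> k) | n \<pi>. up_right_path x y n \<pi>}"
  have bounds: "of_int (fst (y - x) + snd (y - x)) * c \<le> (\<Sum>k<n. \<omega> (\<pi> k)) \<and>
      (\<Sum>k<n. \<omega> (\<pi> k)) \<le> of_int (fst (y - x) + snd (y - x)) * K + F x y"
    if \<pi>: "up_right_path x y n \<pi>" for n \<pi>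
  proof -
    have n: "of_int (fst (y - x) + snd (y - x)) = real n"
      using up_right_path_length[OF \<pi>] by (metis of_int_of_nat_eq)
    have zero: "F x x = 0" using additive[of x x x] by simp
    have "k \<le> n \<Longrightarrow> (\<Sum>j<k. \<omega> (\<pi> j)) \<le> real k * K + F x (\<pi> k)" for k
    proof (induction k)
      case 0 then show ?case using \<pi> zero by (simp add: up_right_path_def)
    next
      case (Suc k)
      have "\<pi> (Suc k) - \<pi> k \<in> {evec 1, evec 2}" using Suc \<pi> by (simp add: up_right_path_def)
      then obtain i where "i \<in> {1, 2}" "\<pi> (Suc k) = \<pi> k + evec i"
        by (metis add.commute diff_add_cancel insertCI insertE singletonD)
      then have "\<omega> (\<pi> k) \<le> K + F (\<pi> k) (\<pi> (Suc k))" using upper by metis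
      then show ?case using Suc additive[of x "\<pi> k" "\<pi> (Suc k)"] by (simp add: algebra_simps)
    qed
    from this[of n] have "(\<Sum>k<n. \<omega> (\<pi> k)) \<le> real n * K + F x y"
      using \<pi> by (simp add: up_right_path_def)
    moreover have "real n * c \<le> (\<Sum>k<n. \<omega> (\<pi> k))"
      using sum_mono[of "{..<n}" "\<lambda>_. c" "\<lambda>k. \<omega> (\<pi> k)"] lower by simp
    ultimately show ?thesis by (simp only: n)
  qed
  have ne: "?S \<noteq> {}" using up_right_path_exists[OF le] by blast
  show "last_passage \<omega> x y \<le> of_int (fst (y - x) + snd (y - x)) * K + F x y"
    unfolding last_passage_def using bounds by (intro Max.boundedI finite_path_sums ne) blast
  obtain n \<pi> where "up_right_path x y n \<pi>" using up_right_path_exists[OF le] by blast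
  then have "of_int (fst (y - x) + snd (y - x)) * c \<le> (\<Sum>k<n. \<omega> (\<pi> k))"
      "(\<Sum>k<n. \<omega> (\<pi> k)) \<in> ?S"
    using bounds by blast+
  then show "of_int (fst (y - x) + snd (y - x)) * c \<le> last_passage \<omega> x y"
    unfolding last_passage_def
    by (rule order_trans[OF _ Max_ge[OF finite_path_sums]])
qed

section \<open>The lower bound in the variational formula\<close>

text \<open>Fatou's lemma applied to the dominating sequence alone, so that the sequence \<open>X\<close>, which will
  be the rescaled last-passage time, may be nonmeasurable. The index 0 is left out because of
  the divisions by \<open>n\<close> to come.\<close>

lemma (in prob_space) le_limit_expectation_if_AE_dominated:
  fixes X Y :: "nat \<Rightarrow> 'a \<Rightarrow> real"
  assumes X: "AE \<omega> in M. (\<forall>n>0. 0 \<le> X n \<omega> \<and> X n \<omega> \<le> Y n \<omega>) \<and> (\<lambda>n. X n \<omega>) \<longlonglongrightarrow> l"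
    and Y: "\<And>n. integrable M (Y n)" "(\<lambda>n. expectation (Y n)) \<longlonglongrightarrow> m"
  shows "l \<le> m"
proof -
  have nonneg: "AE \<omega> in M. 0 \<le> Y n \<omega>" if "n > 0" for n
    using X by eventually_elim (meson order_trans that)
  have "ennreal l = (\<integral>\<^sup>+\<omega>. ennreal l \<partial>M)" by (simp add: emeasure_space_1)
  also have "\<dots> \<le> (\<integral>\<^sup>+\<omega>. liminf (\<lambda>n. ennreal (Y n \<omega>)) \<partial>M)"
  proof (rule nn_integral_mono_AE)
    show "AE \<omega> in M. ennreal l \<le> liminf (\<lambda>n. ennreal (Y n \<omega>))"
      using X
    proof eventually_elim
      case (elim \<omega>)
      then have "(\<lambda>n. ennreal (X n \<omega>)) \<longlonglongrightarrow> ennreal l"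
        by (intro tendsto_ennrealI) simp
      then have "ennreal l = liminf (\<lambda>n. ennreal (X n \<omega>))" by (simp add: lim_imp_Liminf)
      also have "\<dots> \<le> liminf (\<lambda>n. ennreal (Y n \<omega>))"
        by (intro Liminf_mono eventually_sequentiallyI[of 1])
           (use elim in \<open>auto intro!: ennreal_leI\<close>)
      finally show ?case .
    qed
  qed
  also have "\<dots> \<le> liminf (\<lambda>n. \<integral>\<^sup>+\<omega>. ennreal (Y n \<omega>) \<partial>M)"
    by (rule nn_integral_liminf) (use Y(1) in auto)
  also have "\<dots> = liminf (\<lambda>n. ennreal (expectation (Y n)))"
    by (intro Liminf_eq eventually_sequentiallyI[of 1] nn_integral_eq_integral Y(1) nonneg) simp
  also have "\<dots> = ennreal m"
    using Y(2) by (intro lim_imp_Liminf tendsto_ennrealI) simp_all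
  finally have "ennreal l \<le> ennreal m" .
  moreover have "0 \<le> m"
  proof (rule tendsto_lowerbound[OF Y(2)])
    show "\<forall>\<^sub>F n in sequentially. 0 \<le> expectation (Y n)"
      by (intro eventually_sequentiallyI[of 1] integral_nonneg_AE nonneg) simp
  qed simp
  ultimately show ?thesis by (simp add: ennreal_le_iff)
qed

lemma floor_multiple_over: "(\<lambda>n. of_int \<lfloor>real n * a\<rfloor> / real n) \<longlonglongrightarrow> a"
proof (rule tendsto_sandwich)
  show "\<forall>\<^sub>F n in sequentially. a - 1 / real n \<le> of_int \<lfloor>real n * a\<rfloor> / real n"
  proof (rule eventually_sequentiallyI[of 1])
    fix n :: nat assume "1 \<le> n"
    have "real n * a - 1 \<le> of_int \<lfloor>real n * a\<rfloor>" by linarith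
    then have "(real n * a - 1) / real n \<le> of_int \<lfloor>real n * a\<rfloor> / real n"
      by (rule divide_right_mono) simp
    then show "a - 1 / real n \<le> of_int \<lfloor>real n * a\<rfloor> / real n"
      using \<open>1 \<le> n\<close> by (simp add: diff_divide_distrib)
  qed
  show "\<forall>\<^sub>F n in sequentially. of_int \<lfloor>real n * a\<rfloor> / real n \<le> a"
    by (rule eventually_sequentiallyI[of 1]) (simp add: divide_le_eq mult.commute)
  have "(\<lambda>n. a - 1 / real n) \<longlonglongrightarrow> a - 0" by (intro tendsto_intros lim_1_over_n)
  then show "(\<lambda>n. a - 1 / real n) \<longlonglongrightarrow> a" by simp
qed simp

lemma shift_measurable [measurable]: "shift z \<in> Env \<rightarrow>\<^sub>M Env"
  unfolding shift_def by (rule measurable_PiM_single') auto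

lemma AE_all_shifts:
  assumes T: "\<And>z. T z \<in> M \<rightarrow>\<^sub>M M" "\<And>z. distr M M (T z) = M"
    and "AE \<omega> in M. Q \<omega>"
  shows "AE \<omega> in M. \<forall>z :: site. Q (T z \<omega>)"
proof -
  have "AE \<omega> in M. Q (T z \<omega>)" for z
    using AE_distrD[OF T(1)[of z]] assms(3) unfolding T(2)[of z] by blast
  then show ?thesis by (simp add: AE_all_countable)
qed

context lpp_model
begin

lemma space_P [simp]: "space P = UNIV"
  using sets_eq_imp_space_eq[OF sets_P] by (simp add: space_PiM)

lemma measurable_P_eq [simp]: "measurable P N = measurable Env N" "measurable N P = measurable N Env"
  using measurable_cong_sets[OF sets_P refl] measurable_cong_sets[OF refl sets_P] by blast+

text \<open>By stationarity the bound holds at every site, so the last-passage time to \<open>floor_site (n \<xi>)\<close> is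
  at most a deterministic linear term plus a cocycle value. The mean of the cocycle value grows
  like \<open>- n (h \<bullet> \<xi>)\<close> and cancels the term \<open>h \<bullet> \<xi>\<close> of the bound, leaving \<open>k\<close>.\<close>

lemma gpp_le_if_AE_bound:
  assumes invariant: "\<And>z. distr P P (shift z) = P"
    and \<xi>: "\<xi> \<in> riU" and C: "C \<in> cocycles P"
    and bound: "AE \<omega> in P. \<forall>i\<in>{1, 2}. \<omega> 0 - C \<omega> 0 (evec i) - hvec P C \<bullet> \<xi> \<le> k"
  shows "gpp P \<xi> \<le> k"
proof -
  have T: "shift z \<in> P \<rightarrow>\<^sub>M P" for z using shift_measurable by simp
  have cocycle: "stationary_L1_cocycle P shift C" using C by (simp add: cocycles_def)
  obtain a b where ab: "\<xi> = (a, b)" "0 < a" "0 < b" "a + b = 1"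
    using \<xi> by (auto simp: riU_def)
  define h where "h = hvec P C"
  define K where "K = k + h \<bullet> \<xi>"
  obtain c where "prob {\<omega> \<in> space P. c \<le> \<omega> 0} = 1" using weights_bdd_below by blast
  then have "AE \<omega> in P. \<omega> \<in> {\<omega> \<in> space P. c \<le> \<omega> 0}"
    by (rule AE_prob_1)
  then have c: "AE \<omega> in P. c \<le> \<omega> 0" by simp
  define v where "v n = floor_site (real n *\<^sub>R \<xi>)" for n
  define N where "N n = real_of_int (fst (v n) + snd (v n))" for n
  \<comment> \<open>Subtracting the lower bound \<open>c\<close> of the weights from every step makes both sequences
    nonnegative.\<close>
  define X where "X n \<omega> = last_passage \<omega> 0 (v n) / real n - c * (N n / real n)" for n \<omega>
  define Y where "Y n \<omega> = (K - c) * (N n / real n) + C \<omega> 0 (v n) / real n" for n \<omega>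
  have v: "v n = (\<lfloor>real n * a\<rfloor>, \<lfloor>real n * b\<rfloor>)" for n
    by (simp add: v_def floor_site_def ab)
  have v_nonneg: "0 \<le> fst (v n)" "0 \<le> snd (v n)" for n
    using ab by (simp_all add: v)
  have v_lim: "(\<lambda>n. of_int (fst (v n)) / real n) \<longlonglongrightarrow> a" "(\<lambda>n. of_int (snd (v n)) / real n) \<longlonglongrightarrow> b"
    using floor_multiple_over by (simp_all add: v)
  then have N_lim: "(\<lambda>n. N n / real n) \<longlonglongrightarrow> 1"
    using tendsto_add[OF v_lim] ab by (simp add: N_def add_divide_distrib)
  have mean: "integrable P (\<lambda>\<omega>. C \<omega> x y)" "expectation (\<lambda>\<omega>. C \<omega> x y) = - h \<bullet> real_site (y - x)" for x y
    using cocycle_mean[OF cocycle T invariant] by (auto simp: h_def)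
  have "gpp P \<xi> - c * 1 \<le> K - c - h \<bullet> \<xi>"
  proof (rule le_limit_expectation_if_AE_dominated)
    have "AE \<omega> in P. (\<lambda>n. last_passage \<omega> 0 (v n) / real n) \<longlonglongrightarrow> gpp P \<xi>"
      using gpp_limit[of \<xi>] ab by (simp add: lpp_tendsto_def v_def quadrant_def)
    moreover have "AE \<omega> in P. \<forall>z. c \<le> shift z \<omega> 0"
      by (rule AE_all_shifts[OF T invariant c])
    moreover have "AE \<omega> in P. \<forall>z. \<forall>i\<in>{1, 2}.
        shift z \<omega> 0 - C (shift z \<omega>) 0 (evec i) - hvec P C \<bullet> \<xi> \<le> k"
      by (rule AE_all_shifts[OF T invariant bound])
    moreover have "AE \<omega> in P. \<forall>x y z. C \<omega> (z + x) (z + y) = C (shift z \<omega>) x y \<and>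
        C \<omega> x y + C \<omega> y z = C \<omega> x z"
      by (rule stationary_L1_cocycleD(3)[OF cocycle])
    ultimately show "AE \<omega> in P. (\<forall>n>0. 0 \<le> X n \<omega> \<and> X n \<omega> \<le> Y n \<omega>) \<and>
        (\<lambda>n. X n \<omega>) \<longlonglongrightarrow> gpp P \<xi> - c * 1"
    proof eventually_elim
      case (elim \<omega>)
      have lower: "c \<le> \<omega> z" for z using elim(2)[rule_format, of z] by (simp add: shift_def)
      have upper: "\<omega> z \<le> K + C \<omega> z (z + evec i)" if "i \<in> {1, 2}" for z i
      proof -
        have "C \<omega> z (z + evec i) = C (shift z \<omega>) 0 (evec i)"
          using elim(4) by (metis add_0_right)
        then show ?thesis using elim(3)[rule_format, OF that, of z]
          by (simp add: shift_def K_def h_def algebra_simps)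
      qed
      have additive: "C \<omega> x y + C \<omega> y z = C \<omega> x z" for x y z using elim(4) by blast
      have "N n * c \<le> last_passage \<omega> 0 (v n) \<and> last_passage \<omega> 0 (v n) \<le> N n * K + C \<omega> 0 (v n)" for n
        using last_passage_bounds[where x = 0 and y = "v n" and \<omega> = \<omega> and F = "C \<omega>", OF _ _ lower upper additive]
          v_nonneg by (simp add: N_def)
      then have "0 \<le> X n \<omega> \<and> X n \<omega> \<le> Y n \<omega>" if "n > 0" for n
        using that by (simp add: X_def Y_def field_simps)
      moreover have "(\<lambda>n. X n \<omega>) \<longlonglongrightarrow> gpp P \<xi> - c * 1"
        unfolding X_def by (intro tendsto_intros elim(1) N_lim)
      ultimately show ?case by blast
    qed
    show "integrable P (Y n)" for n
      unfolding Y_def using mean(1) by simp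
    have EY: "expectation (Y n) = (K - c) * (N n / real n)
        - (fst h * (of_int (fst (v n)) / real n) + snd h * (of_int (snd (v n)) / real n))" for n
      unfolding Y_def using mean(1)[of 0 "v n"] mean(2)[of 0 "v n"]
      by (simp add: prob_space[unfolded space_P] real_site_def inner_prod_def add_divide_distrib diff_divide_distrib)
    have "(\<lambda>n. expectation (Y n)) \<longlonglongrightarrow> (K - c) * 1 - (fst h * a + snd h * b)"
      unfolding EY by (intro tendsto_intros v_lim N_lim)
    then show "(\<lambda>n. expectation (Y n)) \<longlonglongrightarrow> K - c - h \<bullet> \<xi>"
      by (simp add: ab inner_prod_def)
  qed
  then show ?thesis by (simp add: K_def)
qed

lemma gpp_le_var_functional:
  assumes "\<And>z. distr P P (shift z) = P" "\<xi> \<in> riU" "C \<in> cocycles P"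
  shows "ereal (gpp P \<xi>) \<le> var_functional P \<xi> C"
proof (rule ereal_le_real)
  fix k assume k: "var_functional P \<xi> C \<le> ereal k"
  have "AE \<omega> in P. ereal (MAX i\<in>{1, 2}. \<omega> 0 - C \<omega> 0 (evec i) - hvec P C \<bullet> \<xi>) \<le> var_functional P \<xi> C"
    unfolding var_functional_def by (rule esssup_AE)
  then have "AE \<omega> in P. \<forall>i\<in>{1, 2}. \<omega> 0 - C \<omega> 0 (evec i) - hvec P C \<bullet> \<xi> \<le> k"
  proof eventually_elim
    case (elim \<omega>)
    then have "ereal (MAX i\<in>{1, 2}. \<omega> 0 - C \<omega> 0 (evec i) - hvec P C \<bullet> \<xi>) \<le> ereal k"
      using k by (rule order_trans)
    then show ?case by simp
  qed
  then show "ereal (gpp P \<xi>) \<le> ereal k" using gpp_le_if_AE_bound[OF assms] by simp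
qed

end

section \<open>Conditional expectations of cocycles given the weights\<close>

lemma hat_shift_measurable: "hat_shift z \<in> HatEnv A \<rightarrow>\<^sub>M HatEnv A"
proof -
  define I :: "(nat \<times> real \<times> site) set" where "I = {1, 2} \<times> A \<times> UNIV"
  define M :: "hat_env measure" where "M = Env \<Otimes>\<^sub>M PiM I (\<lambda>_. borel)"
  have I: "(i, a, z + y) \<in> I \<longleftrightarrow> (i, a, y) \<in> I" for i a y by (simp add: I_def)
  have "(\<lambda>w. \<lambda>(i, a, y). snd w (i, a, z + y)) \<in> M \<rightarrow>\<^sub>M PiM I (\<lambda>_. borel)"
  proof (rule measurable_PiM_single)
    show "(\<lambda>w. \<lambda>(i, a, y). snd w (i, a, z + y)) \<in> space M \<rightarrow> (\<Pi>\<^sub>E i\<in>I. space borel)"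
    proof (intro funcsetI PiE_I)
      fix w j assume w: "w \<in> space M" and j: "j \<notin> I"
      obtain i a y where "j = (i, a, y)" by (rule prod_cases3)
      have "(i, a, z + y) \<notin> I" using j I \<open>j = (i, a, y)\<close> by simp
      moreover have "snd w \<in> extensional I"
        using w by (auto simp: M_def space_pair_measure space_PiM PiE_def)
      ultimately have "snd w (i, a, z + y) = undefined" by (rule extensional_arb[rotated])
      then show "(case j of (i, a, y) \<Rightarrow> snd w (i, a, z + y)) = undefined"
        by (simp only: \<open>j = (i, a, y)\<close> prod.case)
    qed simp
    fix S :: "real set" and j assume "j \<in> I" and S: "S \<in> sets borel"
    obtain i a y where j: "j = (i, a, y)" by (rule prod_cases3)
    have "(i, a, z + y) \<in> I" using \<open>j \<in> I\<close> I by (simp add: j)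
    then have "(\<lambda>w. snd w (i, a, z + y)) \<in> M \<rightarrow>\<^sub>M borel"
      unfolding M_def
      by (rule measurable_compose[OF measurable_snd measurable_component_singleton])
    from measurable_sets[OF this S]
    show "{w \<in> space M. (case j of (i, a, y) \<Rightarrow> snd w (i, a, z + y)) \<in> S} \<in> sets M"
      by (simp add: j vimage_def Int_def conj_commute)
  qed
  moreover have "(\<lambda>w. shift z (fst w)) \<in> M \<rightarrow>\<^sub>M Env"
    unfolding M_def by (rule measurable_compose[OF measurable_fst shift_measurable])
  ultimately have "(\<lambda>w. (shift z (fst w), \<lambda>(i, a, y). snd w (i, a, z + y))) \<in> M \<rightarrow>\<^sub>M M"
    unfolding M_def by (rule measurable_Pair[rotated])
  moreover have "hat_shift z = (\<lambda>w. (shift z (fst w), (\<lambda>(i, a, y). snd w (i, a, z + y))))"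
    unfolding hat_shift_def by (rule ext) (simp only: case_prod_beta)
  ultimately show ?thesis unfolding M_def I_def by simp
qed

lemma cond_exp_versionD:
  assumes "cond_exp_version P Ph D C"
  shows "(\<lambda>\<omega>. C \<omega> x y) \<in> borel_measurable P"
    and "AE w in Ph. C (fst w) x y =
      real_cond_exp Ph (vimage_algebra (space Ph) fst P) (\<lambda>w. D w x y) w"
  using assms unfolding cond_exp_version_def by blast+

text \<open>A version of the conditional expectation given the projection is a function of the projected
  point. The factor is rebuilt from the sublevel sets of \<open>f\<close> at rational heights, each of which
  is the preimage of a measurable set.\<close>

lemma measurable_vimage_algebra_factor:
  fixes f :: "'a \<Rightarrow> real"
  assumes T: "T \<in> \<Omega> \<rightarrow> space N" and f: "f \<in> borel_measurable (vimage_algebra \<Omega> T N)"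
  shows "\<exists>g \<in> borel_measurable N. \<forall>w\<in>\<Omega>. f w = g (T w)"
proof -
  have "\<exists>S\<in>sets N. {w \<in> \<Omega>. f w < of_rat q} = T -` S \<inter> \<Omega>" for q
  proof -
    have "{w \<in> \<Omega>. f w < of_rat q} \<in> sets (vimage_algebra \<Omega> T N)"
      using borel_measurable_less[OF f measurable_const[of "of_rat q"]] by simp
    then show ?thesis by (auto simp: sets_vimage_algebra2[OF T])
  qed
  then obtain S where S: "S q \<in> sets N" "{w \<in> \<Omega>. f w < of_rat q} = T -` S q \<inter> \<Omega>" for q
    by metis
  define g where "g y = (INF q. if y \<in> S q then ereal (of_rat q) else \<infinity>)" for y
  have [measurable]: "g \<in> borel_measurable N"
    unfolding g_def using S(1) by measurable
  have "g (T w) = ereal (f w)" if "w \<in> \<Omega>" for w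
  proof (rule antisym)
    have mem: "T w \<in> S q \<longleftrightarrow> f w < of_rat q" for q using S(2)[of q] that by blast
    show "ereal (f w) \<le> g (T w)"
      unfolding g_def by (rule INF_greatest) (auto simp: mem)
    show "g (T w) \<le> ereal (f w)"
    proof (rule dense_ge)
      fix y assume "ereal (f w) < y"
      then obtain r where "ereal (f w) < ereal r" "ereal r < y" using ereal_dense2 by blast
      then obtain q where q: "f w < of_rat q" "of_rat q < r" using of_rat_dense by auto
      have "g (T w) \<le> (if T w \<in> S q then ereal (of_rat q) else \<infinity>)"
        unfolding g_def by (rule INF_lower) simp
      also have "\<dots> \<le> y" using q \<open>ereal r < y\<close> by (simp add: mem) (metis ereal_less_eq(3) less_imp_le order_trans)
      finally show "g (T w) \<le> y" .
    qed
  qed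
  then have "\<forall>w\<in>\<Omega>. f w = real_of_ereal (g (T w))" by simp
  moreover have "(\<lambda>y. real_of_ereal (g y)) \<in> borel_measurable N" by measurable
  ultimately show ?thesis by (intro bexI)
qed

context cocycle_family
begin

lemma hat_shift_Ph: "hat_shift z \<in> Ph \<rightarrow>\<^sub>M Ph"
  using hat_shift_measurable measurable_cong_sets[OF sets_Ph sets_Ph] by blast

lemma fst_measurable [measurable]: "fst \<in> Ph \<rightarrow>\<^sub>M Env"
  using measurable_cong_sets[OF sets_Ph refl] measurable_fst by blast

lemma distr_fst: "distr Ph P fst = P"
  using marginal by (simp add: distr_cong[OF refl sets_P refl])

text \<open>The projection to the weights intertwines the two shifts, so the law of the weights inherits
  the invariance of the extended law.\<close>

lemma P_invariant: "distr P P (shift z) = P"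
proof -
  have comm: "shift z \<circ> fst = fst \<circ> hat_shift z"
    by (auto simp: hat_shift_def fun_eq_iff)
  have "distr P P (shift z) = distr (distr Ph P fst) P (shift z)" by (simp add: distr_fst)
  also have "\<dots> = distr Ph P (fst \<circ> hat_shift z)"
    by (subst distr_distr) (simp_all add: comm)
  also have "\<dots> = distr (distr Ph Ph (hat_shift z)) P fst"
    by (subst distr_distr) (simp_all add: hat_shift_Ph)
  finally show ?thesis by (simp add: Ph_invariant distr_fst)
qed

abbreviation weight_algebra :: "hat_env measure" where
  "weight_algebra \<equiv> vimage_algebra (space Ph) fst P"

lemma sets_weight_algebra: "sets weight_algebra = {fst -` S \<inter> space Ph | S. S \<in> sets P}"
  by (rule sets_vimage_algebra2) simp

lemma measurable_weight_algebra:
  "f \<in> borel_measurable P \<Longrightarrow> (\<lambda>w. f (fst w)) \<in> borel_measurable weight_algebra"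
  using measurable_compose[OF measurable_vimage_algebra1[of fst "space Ph" P]] by simp

lemma subalgebra_weight_algebra: "subalgebra Ph weight_algebra"
  using measurable_sets[OF fst_measurable] by (auto simp: subalgebra_def sets_weight_algebra sets_P)

sublocale ce: sigma_finite_subalgebra Ph weight_algebra
proof -
  have "finite_measure_subalgebra Ph weight_algebra"
    by unfold_locales (rule subalgebra_weight_algebra)
  then show "sigma_finite_subalgebra Ph weight_algebra"
    by (rule finite_measure_subalgebra_is_sigma_finite)
qed

lemma AE_weights_iff:
  assumes "{\<omega>. Q \<omega>} \<in> sets P"
  shows "(AE \<omega> in P. Q \<omega>) \<longleftrightarrow> (AE w in Ph. Q (fst w))"
  using AE_distr_iff[of fst Ph P Q, unfolded distr_fst] assms by simp

lemma cond_exp_version_exists: "\<exists>C. cond_exp_version P Ph D C"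
proof -
  have "\<exists>g\<in>borel_measurable P. \<forall>w\<in>space Ph.
      real_cond_exp Ph weight_algebra (\<lambda>w. D w x y) w = g (fst w)" for x y
    by (rule measurable_vimage_algebra_factor) auto
  then obtain C where "C x y \<in> borel_measurable P"
    and "\<forall>w\<in>space Ph. real_cond_exp Ph weight_algebra (\<lambda>w. D w x y) w = C x y (fst w)" for x y
    by metis
  then have "cond_exp_version P Ph D (\<lambda>\<omega> x y. C x y \<omega>)"
    by (auto simp: cond_exp_version_def)
  then show ?thesis by blast
qed

text \<open>Both sides are functions of the weights, so by uniqueness of conditional expectations they need
  only have the same integrals over events \<open>fst w \<in> S\<close>. Translating such an event back by \<open>z\<close>
  gives another event of this kind, and the stationarity of \<open>D\<close> together with the invariance of
  the extended law turns one integral into the other.\<close>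

lemma cond_exp_version_shift:
  assumes D: "stationary_L1_cocycle Ph hat_shift D" and C: "cond_exp_version P Ph D C"
  shows "AE \<omega> in P. C \<omega> (z + x) (z + y) = C (shift z \<omega>) x y"
proof -
  have Dint: "integrable Ph (\<lambda>w. D w x y)" for x y
    using cocycle_mean[OF D hat_shift_Ph Ph_invariant] by blast
  have Cmeas [measurable]: "(\<lambda>\<omega>. C \<omega> x y) \<in> borel_measurable Env" for x y
    using cond_exp_versionD(1)[OF C] by simp
  note CE = cond_exp_versionD(2)[OF C]
  have Cfst: "(\<lambda>w. C (fst w) x y) \<in> borel_measurable Ph" for x y
    by measurable
  have Cint: "integrable Ph (\<lambda>w. C (fst w) x y)" for x y
    using integrable_cong_AE[OF Cfst _ CE] ce.real_cond_exp_int(1)[OF Dint] by simp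
  have [measurable]: "hat_shift z \<in> Ph \<rightarrow>\<^sub>M Ph" by (rule hat_shift_Ph)
  have fst_shift: "fst (hat_shift z w) = shift z (fst w)" for w
    by (simp add: hat_shift_def split: prod.split)
  have integral_shift: "(\<integral>w. f (hat_shift z w) \<partial>Ph) = (\<integral>w. f w \<partial>Ph)"
    if [measurable]: "f \<in> borel_measurable Ph" for f :: "_ \<Rightarrow> real"
    using integral_distr[OF hat_shift_Ph[of z] that] by (simp add: Ph_invariant)
  have "AE w in Ph. real_cond_exp Ph weight_algebra (\<lambda>w. D w (z + x) (z + y)) w = C (shift z (fst w)) x y"
  proof (rule ce.real_cond_exp_charact)
    fix E assume "E \<in> sets weight_algebra"
    then obtain S where S: "S \<in> sets P" "E = fst -` S \<inter> space Ph"
      by (auto simp: sets_weight_algebra)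
    define S' where "S' = shift (- z) -` S"
    have "S' \<in> sets P"
      using measurable_sets[OF shift_measurable[of "- z"], of S] S(1)
      by (simp add: S'_def sets_P space_PiM)
    then have E'w: "fst -` S' \<inter> space Ph \<in> sets weight_algebra" by (auto simp: sets_weight_algebra)
    define E' where "E' = fst -` S' \<inter> space Ph"
    have E'[measurable]: "E' \<in> sets Ph"
      using E'w subalgebra_weight_algebra by (auto simp: subalgebra_def E'_def)
    have ind: "indicator E w = (indicator E' (hat_shift z w) :: real)" if "w \<in> space Ph" for w
    proof -
      have "shift (- z) (shift z (fst w)) = fst w" by (simp add: shift_def fun_eq_iff)
      then show ?thesis
        using that measurable_space[OF hat_shift_Ph that, of z]
        by (simp add: S(2) E'_def S'_def fst_shift indicator_def)
    qed
    have Dmeas [measurable]: "(\<lambda>w. D w x y) \<in> borel_measurable Ph" for x y using Dint by blast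
    have Em[measurable]: "E \<in> sets Ph"
      using \<open>E \<in> sets weight_algebra\<close> subalgebra_weight_algebra by (auto simp: subalgebra_def)
    have "AE w in Ph. D w (z + x) (z + y) = D (hat_shift z w) x y"
      using stationary_L1_cocycleD(3)[OF D] by eventually_elim blast
    then have "(\<integral>w. indicator E w * D w (z + x) (z + y) \<partial>Ph)
        = (\<integral>w. indicator E' (hat_shift z w) * D (hat_shift z w) x y \<partial>Ph)"
      by (intro integral_cong_AE) (auto simp: ind)
    also have "\<dots> = (\<integral>w. indicator E' w * D w x y \<partial>Ph)"
      by (rule integral_shift) measurable
    also have "\<dots> = (\<integral>w. indicator E' w * real_cond_exp Ph weight_algebra (\<lambda>w. D w x y) w \<partial>Ph)"
      using ce.real_cond_exp_intA[OF Dint E'w] by (simp add: set_lebesgue_integral_def E'_def)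
    also have "\<dots> = (\<integral>w. indicator E' w * C (fst w) x y \<partial>Ph)"
      using CE[of x y] by (intro integral_cong_AE) auto
    also have "\<dots> = (\<integral>w. indicator E' (hat_shift z w) * C (fst (hat_shift z w)) x y \<partial>Ph)"
      by (rule integral_shift[symmetric]) measurable
    also have "\<dots> = (\<integral>w. indicator E w * C (shift z (fst w)) x y \<partial>Ph)"
      by (intro Bochner_Integration.integral_cong) (auto simp: ind fst_shift)
    finally show "(\<integral>w\<in>E. D w (z + x) (z + y) \<partial>Ph) = (\<integral>w\<in>E. C (shift z (fst w)) x y \<partial>Ph)"
      by (simp add: set_lebesgue_integral_def)
  next
    show "integrable Ph (\<lambda>w. D w (z + x) (z + y))" by (rule Dint)
    have "integrable (distr Ph Ph (hat_shift z)) (\<lambda>w. C (fst w) x y)"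
      using Cint by (simp add: Ph_invariant)
    then show "integrable Ph (\<lambda>w. C (shift z (fst w)) x y)"
      by (subst (asm) integrable_distr_eq) (auto simp: fst_shift)
    show "(\<lambda>w. C (shift z (fst w)) x y) \<in> borel_measurable weight_algebra"
      by (rule measurable_weight_algebra) simp
  qed
  then have "AE w in Ph. C (fst w) (z + x) (z + y) = C (shift z (fst w)) x y"
    using CE[of "z + x" "z + y"] by eventually_elim simp
  moreover have "{\<omega>. C \<omega> (z + x) (z + y) = C (shift z \<omega>) x y} \<in> sets P"
  proof -
    have "{\<omega> \<in> space Env. C \<omega> (z + x) (z + y) = C (shift z \<omega>) x y} \<in> sets Env" by measurable
    then show ?thesis by (simp add: sets_P space_PiM)
  qed
  ultimately show ?thesis by (simp add: AE_weights_iff)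
qed

text \<open>Conditioning is linear, which preserves additivity, and it preserves means, which preserves the
  vector \<open>h\<close>.\<close>

lemma cond_exp_version_cocycle:
  assumes D: "stationary_L1_cocycle Ph hat_shift D" and C: "cond_exp_version P Ph D C"
  shows "C \<in> cocycles P" and "hvec P C = hvec Ph D"
proof -
  have Dint: "integrable Ph (\<lambda>w. D w x y)" for x y
    using cocycle_mean[OF D hat_shift_Ph Ph_invariant] by blast
  have Cmeas [measurable]: "(\<lambda>\<omega>. C \<omega> x y) \<in> borel_measurable Env" for x y
    using cond_exp_versionD(1)[OF C] by simp
  note CE = cond_exp_versionD(2)[OF C]
  have Cfst: "(\<lambda>w. C (fst w) x y) \<in> borel_measurable Ph" for x y by measurable
  have Cint: "integrable P (\<lambda>\<omega>. C \<omega> x y)" for x y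
  proof -
    have "integrable Ph (\<lambda>w. C (fst w) x y)"
      using integrable_cong_AE[OF Cfst _ CE] ce.real_cond_exp_int(1)[OF Dint] by simp
    then have "integrable (distr Ph P fst) (\<lambda>\<omega>. C \<omega> x y)"
      by (subst integrable_distr_eq) auto
    then show ?thesis by (simp add: distr_fst)
  qed
  have "expectation (\<lambda>\<omega>. C \<omega> x y) = (\<integral>w. D w x y \<partial>Ph)" for x y
  proof -
    have "expectation (\<lambda>\<omega>. C \<omega> x y) = (\<integral>\<omega>. C \<omega> x y \<partial>distr Ph P fst)" by (simp add: distr_fst)
    also have "\<dots> = (\<integral>w. C (fst w) x y \<partial>Ph)" by (rule integral_distr) auto
    also have "\<dots> = (\<integral>w. D w x y \<partial>Ph)"
      using integral_cong_AE[OF Cfst _ CE] ce.real_cond_exp_int(2)[OF Dint] by simp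
    finally show ?thesis .
  qed
  then show "hvec P C = hvec Ph D" by (simp add: hvec_def)
  have add: "AE \<omega> in P. C \<omega> x y + C \<omega> y z = C \<omega> x z" for x y z
  proof -
    have "AE w in Ph. D w x y + D w y z = D w x z"
      using stationary_L1_cocycleD(3)[OF D] by eventually_elim blast
    then have "AE w in Ph. real_cond_exp Ph weight_algebra (\<lambda>w. D w x y + D w y z) w
        = real_cond_exp Ph weight_algebra (\<lambda>w. D w x z) w"
      using Dint by (intro ce.real_cond_exp_cong) auto
    then have "AE w in Ph. C (fst w) x y + C (fst w) y z = C (fst w) x z"
      using CE[of x y] CE[of y z] CE[of x z] ce.real_cond_exp_add[OF Dint[of x y] Dint[of y z]]
      by eventually_elim simp
    moreover have "{\<omega> \<in> space Env. C \<omega> x y + C \<omega> y z = C \<omega> x z} \<in> sets Env" by measurable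
    ultimately show ?thesis by (simp add: AE_weights_iff sets_P space_PiM)
  qed
  have "AE \<omega> in P. \<forall>x y z. C \<omega> (z + x) (z + y) = C (shift z \<omega>) x y \<and> C \<omega> x y + C \<omega> y z = C \<omega> x z"
    unfolding AE_all_countable AE_conj_iff using add cond_exp_version_shift[OF D C] by blast
  then show "C \<in> cocycles P"
    unfolding cocycles_def stationary_L1_cocycle_def using Cint Cmeas by auto
qed

text \<open>Recovery only survives conditioning as an inequality: the minimum of the two conditioned
  increments may exceed the weight. Monotonicity of the conditional expectation, applied to the
  weight, which is measurable for the sigma-algebra of the condition, gives the half that bounds
  the functional from above.\<close>

lemma cond_exp_version_ge_weight:
  assumes D: "stationary_L1_cocycle Ph hat_shift D" and C: "cond_exp_version P Ph D C"
    and weight: "integrable P (\<lambda>\<omega>. \<omega> 0)" and ge: "AE w in Ph. fst w 0 \<le> D w 0 (evec i)"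
  shows "AE \<omega> in P. \<omega> 0 \<le> C \<omega> 0 (evec i)"
proof -
  have Dint: "integrable Ph (\<lambda>w. D w 0 (evec i))"
    using cocycle_mean[OF D hat_shift_Ph Ph_invariant] by blast
  have [measurable]: "(\<lambda>\<omega>. C \<omega> x y) \<in> borel_measurable Env" for x y
    using cond_exp_versionD(1)[OF C] by simp
  have "integrable (distr Ph P fst) (\<lambda>\<omega>. \<omega> 0)" using weight by (simp add: distr_fst)
  then have int: "integrable Ph (\<lambda>w. fst w 0)"
    by (subst (asm) integrable_distr_eq) auto
  have "AE w in Ph. real_cond_exp Ph weight_algebra (\<lambda>w. fst w 0) w = fst w 0"
    using int measurable_weight_algebra[of "\<lambda>\<omega>. \<omega> 0"] by (intro ce.real_cond_exp_F_meas) auto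
  moreover have "AE w in Ph. C (fst w) 0 (evec i) = real_cond_exp Ph weight_algebra (\<lambda>w. D w 0 (evec i)) w"
    by (rule cond_exp_versionD(2)[OF C])
  ultimately have "AE w in Ph. fst w 0 \<le> C (fst w) 0 (evec i)"
    using ce.real_cond_exp_mono[OF ge int Dint] by eventually_elim simp
  moreover have "{\<omega> \<in> space Env. \<omega> 0 \<le> C \<omega> 0 (evec i)} \<in> sets Env" by measurable
  ultimately show ?thesis by (simp add: AE_weights_iff sets_P space_PiM)
qed

section \<open>The cocycles of the family as minimizers\<close>

lemma AE_recovery_0:
  assumes "\<xi> \<in> riU"
  shows "AE w in Ph. fst w 0 = min (B s \<xi> w 0 (evec 1)) (B s \<xi> w 0 (evec 2))"
  using B_recovery[OF assms, of s] by eventually_elim (metis add_0)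

text \<open>By recovery the weight at the origin almost surely is the minimum of two integrable increments.\<close>

lemma integrable_weight:
  assumes "\<xi> \<in> riU"
  shows "integrable P (\<lambda>\<omega>. \<omega> 0)"
proof -
  have min: "integrable Ph (\<lambda>w. min (B Plus \<xi> w 0 (evec 1)) (B Plus \<xi> w 0 (evec 2)))"
    by (intro integrable_min stationary_L1_cocycleD(2)[OF B_cocycle[OF assms]]) simp_all
  have "integrable Ph (\<lambda>w. fst w 0)"
    by (rule integrable_cong_AE_imp[OF min])
       (use AE_recovery_0[OF assms, of Plus] in \<open>auto elim: eventually_mono\<close>)
  then have "integrable (distr Ph P fst) (\<lambda>\<omega>. \<omega> 0)"
    by (subst integrable_distr_eq) auto
  then show ?thesis by (simp add: distr_fst)
qed

lemma gpp_eq_hvec: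
  assumes "\<xi> \<in> riU"
  shows "gpp P \<xi> = - hvec Ph (B s \<xi>) \<bullet> \<xi>"
proof -
  obtain a b where "\<xi> = (a, b)" "0 < a" "0 < b" using assms by (auto simp: riU_def)
  then show ?thesis
    using euler_one_sided_grad[OF gpp_concave gpp_homogeneous, of a b s] B_hvec[OF assms, of s] by simp
qed

lemma mixture_cocycle:
  assumes "\<xi> \<in> riU"
  shows "stationary_L1_cocycle Ph hat_shift
           (\<lambda>w x y. \<theta> * B Minus \<xi> w x y + (1 - \<theta>) * B Plus \<xi> w x y)"
proof -
  note coc = B_cocycle[OF assms, of Minus] B_cocycle[OF assms, of Plus]
  have "AE w in Ph. \<forall>x y z.
      \<theta> * B Minus \<xi> w (z + x) (z + y) + (1 - \<theta>) * B Plus \<xi> w (z + x) (z + y)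
        = \<theta> * B Minus \<xi> (hat_shift z w) x y + (1 - \<theta>) * B Plus \<xi> (hat_shift z w) x y \<and>
      (\<theta> * B Minus \<xi> w x y + (1 - \<theta>) * B Plus \<xi> w x y) +
        (\<theta> * B Minus \<xi> w y z + (1 - \<theta>) * B Plus \<xi> w y z)
        = \<theta> * B Minus \<xi> w x z + (1 - \<theta>) * B Plus \<xi> w x z"
    using coc[THEN stationary_L1_cocycleD(3)]
  proof eventually_elim
    case (elim w)
    have "B s \<xi> w x z = B s \<xi> w x y + B s \<xi> w y z" for s x y z
      using elim by (cases s; metis)
    note additive = this
    have "B s \<xi> w (z + x) (z + y) = B s \<xi> (hat_shift z w) x y" for s x y z
      using elim by (cases s; blast)
    note stationary = this
    show ?case
    proof (intro allI conjI)
      fix x y z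
      show "\<theta> * B Minus \<xi> w (z + x) (z + y) + (1 - \<theta>) * B Plus \<xi> w (z + x) (z + y)
          = \<theta> * B Minus \<xi> (hat_shift z w) x y + (1 - \<theta>) * B Plus \<xi> (hat_shift z w) x y"
        by (simp only: stationary)
      show "(\<theta> * B Minus \<xi> w x y + (1 - \<theta>) * B Plus \<xi> w x y) +
          (\<theta> * B Minus \<xi> w y z + (1 - \<theta>) * B Plus \<xi> w y z)
          = \<theta> * B Minus \<xi> w x z + (1 - \<theta>) * B Plus \<xi> w x z"
        unfolding additive[of _ x z y] by (simp add: algebra_simps)
    qed
  qed
  then show ?thesis
    unfolding stationary_L1_cocycle_def using coc[THEN stationary_L1_cocycleD(1)] coc[THEN stationary_L1_cocycleD(2)]
    by (intro conjI allI ballI) auto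
qed

text \<open>By Euler's identity both signs give \<open>h \<bullet> \<xi> = - gpp P \<xi>\<close>, hence so does every convex
  combination and its conditional expectation. The rest of the functional is at most zero because
  the increments dominate the weight, so its value is at most the limit shape; the general lower
  bound gives equality.\<close>

lemma mixture_var_functional:
  fixes \<theta> \<xi>
  defines "D \<equiv> \<lambda>w x y. \<theta> * B Minus \<xi> w x y + (1 - \<theta>) * B Plus \<xi> w x y"
  assumes \<xi>: "\<xi> \<in> riU" and \<theta>: "\<theta> \<in> {0..1}" and C: "cond_exp_version P Ph D C"
  shows "C \<in> cocycles P" and "var_functional P \<xi> C = ereal (gpp P \<xi>)"
proof -
  have D: "stationary_L1_cocycle Ph hat_shift D" unfolding D_def by (rule mixture_cocycle[OF \<xi>])
  note C_cocycle = cond_exp_version_cocycle[OF D C]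
  show "C \<in> cocycles P" by (rule C_cocycle)
  have int: "integrable Ph (\<lambda>w. B s \<xi> w 0 (evec 1))" "integrable Ph (\<lambda>w. B s \<xi> w 0 (evec 2))" for s
    using stationary_L1_cocycleD(2)[OF B_cocycle[OF \<xi>, of s]] by blast+
  have "hvec Ph D = \<theta> *\<^sub>R hvec Ph (B Minus \<xi>) + (1 - \<theta>) *\<^sub>R hvec Ph (B Plus \<xi>)"
    using int[of Plus] int[of Minus] by (simp add: hvec_def D_def)
  then have h: "hvec P C \<bullet> \<xi> = - gpp P \<xi>"
    using gpp_eq_hvec[OF \<xi>, of Minus] gpp_eq_hvec[OF \<xi>, of Plus]
    by (simp add: C_cocycle inner_add_left) (simp add: algebra_simps)
  have "AE \<omega> in P. \<omega> 0 \<le> C \<omega> 0 (evec i)" if "i \<in> {1, 2}" for i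
  proof (rule cond_exp_version_ge_weight[OF D C integrable_weight[OF \<xi>]])
    show "AE w in Ph. fst w 0 \<le> D w 0 (evec i)"
      using AE_recovery_0[OF \<xi>, of Minus] AE_recovery_0[OF \<xi>, of Plus]
    proof eventually_elim
      case (elim w)
      then have "fst w 0 \<le> B s \<xi> w 0 (evec i)" for s using that by (cases s) auto
      then have "\<theta> * fst w 0 + (1 - \<theta>) * fst w 0 \<le> D w 0 (evec i)"
        unfolding D_def using \<theta> by (intro add_mono mult_left_mono) auto
      then show ?case by (simp add: algebra_simps)
    qed
  qed
  from this[of 1] this[of 2]
  have "AE \<omega> in P. ereal (MAX i\<in>{1, 2}. \<omega> 0 - C \<omega> 0 (evec i) - hvec P C \<bullet> \<xi>) \<le> ereal (gpp P \<xi>)"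
    by (simp add: h)
  moreover have "(\<lambda>\<omega>. ereal (MAX i\<in>{1, 2}. \<omega> 0 - C \<omega> 0 (evec i) - hvec P C \<bullet> \<xi>)) \<in> borel_measurable P"
  proof -
    have [measurable]: "(\<lambda>\<omega>. C \<omega> 0 y) \<in> borel_measurable Env" for y
      using cond_exp_versionD(1)[OF C] by simp
    show ?thesis by simp
  qed
  ultimately have "var_functional P \<xi> C \<le> ereal (gpp P \<xi>)"
    unfolding var_functional_def by (intro esssup_I)
  then show "var_functional P \<xi> C = ereal (gpp P \<xi>)"
    using gpp_le_var_functional[OF P_invariant \<xi> C_cocycle(1)] by (rule antisym)
qed

lemma variational_formula:
  assumes \<xi>: "\<xi> \<in> riU"
  shows "(INF C\<in>cocycles P. var_functional P \<xi> C) = ereal (gpp P \<xi>)"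
proof (rule antisym)
  obtain C where "cond_exp_version P Ph (\<lambda>w x y. 0 * B Minus \<xi> w x y + (1 - 0) * B Plus \<xi> w x y) C"
    using cond_exp_version_exists by blast
  from mixture_var_functional[OF \<xi> _ this]
  show "(INF C\<in>cocycles P. var_functional P \<xi> C) \<le> ereal (gpp P \<xi>)"
    by (intro INF_lower2[of C]) auto
  show "ereal (gpp P \<xi>) \<le> (INF C\<in>cocycles P. var_functional P \<xi> C)"
    by (intro INF_greatest gpp_le_var_functional P_invariant \<xi>)
qed

end

theorem theorem5p7:
  fixes P :: "env measure" and Ph :: "hat_env measure" and A :: "real set"
    and B :: "side \<Rightarrow> real \<times> real \<Rightarrow> hat_env \<Rightarrow> site \<Rightarrow> site \<Rightarrow> real"
    and \<xi> :: "real \<times> real"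
  assumes "cocycle_family P Ph A B" and "\<xi> \<in> riU"
  shows "(\<forall>s. AE w in Ph.
            gpp P \<xi> = (MAX i\<in>{1, 2}. fst w 0 - B s \<xi> w 0 (evec i) - hvec Ph (B s \<xi>) \<bullet> \<xi>) \<and>
            (MAX i\<in>{1, 2}. fst w 0 - B s \<xi> w 0 (evec i) - hvec Ph (B s \<xi>) \<bullet> \<xi>)
              = - hvec Ph (B s \<xi>) \<bullet> \<xi>) \<and>
         ereal (gpp P \<xi>) = (INF C\<in>cocycles P. var_functional P \<xi> C) \<and>
         (\<forall>\<theta>\<in>{0..1}.
            let D = (\<lambda>w x y. \<theta> * B Minus \<xi> w x y + (1 - \<theta>) * B Plus \<xi> w x y) in
            (\<exists>C. cond_exp_version P Ph D C) \<and>
            (\<forall>C. cond_exp_version P Ph D C \<longrightarrow>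
               C \<in> cocycles P \<and>
               var_functional P \<xi> C = (INF C'\<in>cocycles P. var_functional P \<xi> C')))"
proof -
  interpret cocycle_family P Ph A B by fact
  note \<xi> = \<open>\<xi> \<in> riU\<close>
  have "AE w in Ph.
      gpp P \<xi> = (MAX i\<in>{1, 2}. fst w 0 - B s \<xi> w 0 (evec i) - hvec Ph (B s \<xi>) \<bullet> \<xi>) \<and>
      (MAX i\<in>{1, 2}. fst w 0 - B s \<xi> w 0 (evec i) - hvec Ph (B s \<xi>) \<bullet> \<xi>)
        = - hvec Ph (B s \<xi>) \<bullet> \<xi>" for s
    using AE_recovery_0[OF \<xi>, of s]
  proof eventually_elim
    case (elim w)
    then have "(MAX i\<in>{1, 2}. fst w 0 - B s \<xi> w 0 (evec i) - hvec Ph (B s \<xi>) \<bullet> \<xi>)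
        = - hvec Ph (B s \<xi>) \<bullet> \<xi>"
      by (auto simp: max_def min_def)
    then show ?case using gpp_eq_hvec[OF \<xi>, of s] by simp
  qed
  moreover have "ereal (gpp P \<xi>) = (INF C\<in>cocycles P. var_functional P \<xi> C)"
    by (rule variational_formula[OF \<xi>, symmetric])
  ultimately show ?thesis
    unfolding Let_def
    using mixture_var_functional[OF \<xi>] variational_formula[OF \<xi>] cond_exp_version_exists
    by (intro conjI allI ballI impI) auto
qed

end
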